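(* For every positive integer $n$, there is a bijection between $A(n)$ and $C_{\text{odd}}(n)$. In particular $|A(n)| = |C_{\text{odd}}(n)|$.
   Context: A composition of a positive integer $n$ is a finite sequence $(c_1,\ldots,c_t)$ of positive integers with $\sum c_i = n$. $A(n)$ denotes the set of compositions $(c_1,\ldots,c_t)$ of $n$ such that $c_{2i-1} > c_{2i}$ for every positive integer $i$ with $2i \le t$ (if $t$ is odd, no condition is imposed on the last part). $C_{\text{odd}}(n)$ denotes the set of compositions of $n$ all of whose parts are odd. *)

theory Defs
  imports Main
begin

definition compositions :: "nat \<Rightarrow> nat list set" where
  "compositions n = {c. (\<forall>x \<in> set c. 0 < x) \<and> sum_list c = n}"

text \<open>Parts are numbered from 1 in the mathematics and from 0 by \<open>(!)\<close>, so the
  \<open>j\<close>-th part of \<open>c\<close> is \<open>c ! (j - 1)\<close>.\<close>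

definition A :: "nat \<Rightarrow> nat list set" where
  "A n = {c \<in> compositions n.
     \<forall>i\<ge>1. 2 * i \<le> length c \<longrightarrow> c ! (2 * i - 1 - 1) > c ! (2 * i - 1)}"

definition C_odd :: "nat \<Rightarrow> nat list set" where
  "C_odd n = {c \<in> compositions n. \<forall>x \<in> set c. odd x}"

end

theory Submission
  imports Defs
begin

text \<open>Both counts satisfy \<open>f n = f (n - 1) + f (n - 2)\<close> for \<open>n \<ge> 3\<close> with equal initial values.
  For odd compositions, either delete a first part 1 or subtract 2 from the first part.
  For \<open>A n\<close>, let \<open>D n\<close> consist of the members whose first two parts have the form \<open>b + 1, b\<close>.
  Decrementing the first part maps \<open>A n - D n\<close> bijectively onto \<open>A (n - 1)\<close>. Splitting \<open>D n\<close>
  according to whether \<open>b = 1\<close> gives \<open>|D n| = |A (n - 3)| + |D (n - 2)|\<close>, which is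
  \<open>|A (n - 2)|\<close> by the previous decomposition.\<close>

text \<open>Consuming two parts at a time replaces index arithmetic by a case split: empty,
  singleton, or leading pair.\<close>

fun dec_pairs :: "nat list \<Rightarrow> bool" where
  "dec_pairs (a # b # r) \<longleftrightarrow> b < a \<and> dec_pairs r"
| "dec_pairs _ \<longleftrightarrow> True"

lemma dec_pairs_iff_nth:
  "dec_pairs c \<longleftrightarrow> (\<forall>i\<ge>1. 2 * i \<le> length c \<longrightarrow> c ! (2 * i - 1 - 1) > c ! (2 * i - 1))"
proof (induction c rule: dec_pairs.induct)
  case (1 a b r)
  \<comment> \<open>The instance \<open>i = 1\<close> concerns the leading pair; the others, shifted
    by one, are the condition on \<open>r\<close>.\<close>
  have split: "(\<forall>i\<ge>1. P i) \<longleftrightarrow> P 1 \<and> (\<forall>i\<ge>1. P (Suc i))" for P :: "nat \<Rightarrow> bool"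
    by (auto simp: Suc_le_eq gr0_conv_Suc) (metis not0_implies_Suc)
  have shift: "(a # b # r) ! (2 * Suc i - 1 - 1) = r ! (2 * i - 1 - 1)"
    "(a # b # r) ! (2 * Suc i - 1) = r ! (2 * i - 1)" if "i \<ge> 1" for i
    using that by (cases i; simp)+
  show ?case
    unfolding dec_pairs.simps 1 by (subst split) (use shift in auto)
qed auto

lemma A_iff: "c \<in> A n \<longleftrightarrow> 0 \<notin> set c \<and> sum_list c = n \<and> dec_pairs c"
  unfolding A_def compositions_def dec_pairs_iff_nth by (auto intro: gr0I)

lemma C_odd_iff: "c \<in> C_odd n \<longleftrightarrow> sum_list c = n \<and> (\<forall>x\<in>set c. odd x)"
  unfolding C_odd_def compositions_def by (auto intro: odd_pos)

lemma finite_compositions: "finite (compositions n)"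
proof (rule finite_subset)
  have "length c \<le> sum_list c" if "\<forall>x\<in>set c. 0 < x" for c :: "nat list"
    using that by (induction c) auto
  then show "compositions n \<subseteq> {c. set c \<subseteq> {..n} \<and> length c \<le> n}"
    by (auto simp: compositions_def member_le_sum_list)
qed (simp add: finite_lists_length_le)

lemma finite_A: "finite (A n)"
  by (rule finite_subset[OF _ finite_compositions]) (auto simp: A_def)

lemma finite_C_odd: "finite (C_odd n)"
  by (rule finite_subset[OF _ finite_compositions]) (auto simp: C_odd_def)

text \<open>The value at the empty list makes \<open>[1]\<close> the increment of the empty composition.\<close>

fun inc_hd :: "nat list \<Rightarrow> nat list" where
  "inc_hd [] = [1]"
| "inc_hd (a # r) = Suc a # r"

fun inc_hd2 :: "nat list \<Rightarrow> nat list" where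
  "inc_hd2 (a # b # r) = Suc a # Suc b # r"
| "inc_hd2 c = c"

text \<open>The members with a leading pair whose first part cannot be lowered without breaking
  strict descent.\<close>

definition D :: "nat \<Rightarrow> nat list set" where
  "D n = {c \<in> A n. \<exists>b r. c = Suc b # b # r}"

lemma A_decomp: "A (Suc n) = inc_hd ` A n \<union> D (Suc n)"
proof (intro equalityI subsetI)
  fix c assume c: "c \<in> A (Suc n)"
  show "c \<in> inc_hd ` A n \<union> D (Suc n)"
  proof (cases c rule: dec_pairs.cases)
    case (1 a b r)
    show ?thesis
    proof (cases "a = Suc b")
      case True
      then show ?thesis using c 1 by (auto simp: D_def)
    next
      case False
      then have "c = inc_hd ((a - 1) # b # r)" "(a - 1) # b # r \<in> A n"
        using c 1 by (auto simp: A_iff)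
      then show ?thesis by blast
    qed
  next
    case "2_1"
    then show ?thesis using c by (simp add: A_iff)
  next
    case ("2_2" m)
    \<comment> \<open>A lone part is lowered freely, but \<open>[1]\<close> must go to
      \<open>[]\<close>, because \<open>[0]\<close> has a zero part.\<close>
    then have "c = inc_hd (if n = 0 then [] else [n])" "(if n = 0 then [] else [n]) \<in> A n"
      using c by (auto simp: A_iff)
    then show ?thesis by blast
  qed
next
  fix c assume "c \<in> inc_hd ` A n \<union> D (Suc n)"
  then show "c \<in> A (Suc n)"
  proof
    assume "c \<in> inc_hd ` A n"
    then obtain d where "c = inc_hd d" "d \<in> A n" by blast
    then show ?thesis by (cases d rule: dec_pairs.cases) (auto simp: A_iff)
  qed (simp add: D_def)
qed

text \<open>Positivity matters: \<open>[]\<close> and \<open>[0]\<close> both map to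
  \<open>[1]\<close>, but \<open>[0]\<close> is not in \<open>A n\<close>.\<close>

lemma inj_on_inc_hd: "inj_on inc_hd (A n)"
proof (rule inj_onI)
  fix c d assume "c \<in> A n" "d \<in> A n" "inc_hd c = inc_hd d"
  then show "c = d" by (cases c; cases d) (auto simp: A_iff)
qed

text \<open>A preimage of \<open>Suc b # b # r\<close> would start with the equal parts
  \<open>b\<close>, \<open>b\<close>.\<close>

lemma inc_hd_notin_D: "c \<in> A n \<Longrightarrow> inc_hd c \<notin> D m"
  by (cases c rule: dec_pairs.cases) (auto simp: A_iff D_def)

lemma card_A_Suc: "card (A (Suc n)) = card (A n) + card (D (Suc n))"
proof -
  have "finite (D (Suc n))" using finite_A[of "Suc n"] by (simp add: D_def)
  then show ?thesis
    unfolding A_decomp using inc_hd_notin_D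
    by (subst card_Un_disjoint) (auto simp: finite_A card_image inj_on_inc_hd)
qed

lemma D_decomp: "D (n + 3) = inc_hd2 ` D (n + 1) \<union> (\<lambda>r. 2 # 1 # r) ` A n"
proof (intro equalityI subsetI)
  fix c assume "c \<in> D (n + 3)"
  then obtain b r where c: "c = Suc b # b # r" "c \<in> A (n + 3)" by (auto simp: D_def)
  then obtain b' where b: "b = Suc b'" by (cases b) (auto simp: A_iff)
  show "c \<in> inc_hd2 ` D (n + 1) \<union> (\<lambda>r. 2 # 1 # r) ` A n"
  proof (cases b')
    case 0
    then show ?thesis using c b by (auto simp: A_iff)
  next
    case (Suc k)
    then have "c = inc_hd2 (b # b' # r)" "b # b' # r \<in> D (n + 1)"
      using c b by (auto simp: A_iff D_def)
    then show ?thesis by blast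
  qed
qed (auto simp: D_def A_iff)

lemma card_D: "card (D (n + 3)) = card (A (n + 1))"
proof -
  have fin: "finite (D m)" for m using finite_A[of m] by (simp add: D_def)
  have inj: "inj_on inc_hd2 (D (n + 1))" by (rule inj_onI) (auto simp: D_def)
  \<comment> \<open>Parts are positive, so \<open>inc_hd2\<close> makes the second part at least
    2.\<close>
  have disj: "inc_hd2 ` D (n + 1) \<inter> (\<lambda>r. 2 # 1 # r) ` A n = {}"
    by (auto simp: D_def A_iff)
  have "card (D (n + 3)) = card (D (n + 1)) + card (A n)"
    unfolding D_decomp using fin inj disj
    by (subst card_Un_disjoint) (auto simp: finite_A card_image inj_on_def)
  \<comment> \<open>The decomposition of \<open>A (n + 1)\<close>, read backwards, absorbs the
    \<open>D\<close> term.\<close>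
  then show ?thesis using card_A_Suc[of n] by simp
qed

lemma card_A_rec: "card (A (n + 3)) = card (A (n + 2)) + card (A (n + 1))"
  using card_A_Suc[of "n + 2"] card_D[of n] by (simp add: numeral_3_eq_3)

text \<open>An odd first part other than 1 is at least 3, so subtracting 2 keeps it odd and
  positive. Since \<open>n + 1\<close> is positive, \<open>[]\<close> is excluded; two increments
  would send it to \<open>[2]\<close>.\<close>

lemma C_odd_decomp:
  "C_odd (n + 3) = (#) 1 ` C_odd (n + 2) \<union> (inc_hd \<circ> inc_hd) ` C_odd (n + 1)"
proof (intro equalityI subsetI)
  fix c assume c: "c \<in> C_odd (n + 3)"
  then obtain a r where ar: "c = a # r" by (cases c) (auto simp: C_odd_iff)
  show "c \<in> (#) 1 ` C_odd (n + 2) \<union> (inc_hd \<circ> inc_hd) ` C_odd (n + 1)"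
  proof (cases "a = 1")
    case True
    then show ?thesis using c ar by (auto simp: C_odd_iff)
  next
    case False
    obtain k where "a = Suc (2 * k)" using c ar by (auto simp: C_odd_iff elim: oddE)
    with False obtain k' where a: "a = Suc (Suc (Suc (2 * k')))" by (cases k) auto
    then have "c = (inc_hd \<circ> inc_hd) (Suc (2 * k') # r)" "Suc (2 * k') # r \<in> C_odd (n + 1)"
      using c ar by (auto simp: C_odd_iff)
    then show ?thesis by blast
  qed
next
  fix c assume "c \<in> (#) 1 ` C_odd (n + 2) \<union> (inc_hd \<circ> inc_hd) ` C_odd (n + 1)"
  then show "c \<in> C_odd (n + 3)"
  proof
    assume "c \<in> (inc_hd \<circ> inc_hd) ` C_odd (n + 1)"
    then obtain d where "c = inc_hd (inc_hd d)" "d \<in> C_odd (n + 1)" by auto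
    then show ?thesis by (cases d) (auto simp: C_odd_iff)
  qed (auto simp: C_odd_iff)
qed

lemma card_C_odd_rec: "card (C_odd (n + 3)) = card (C_odd (n + 2)) + card (C_odd (n + 1))"
proof -
  have inj: "inj_on (inc_hd \<circ> inc_hd) (C_odd (n + 1))"
  proof (rule inj_onI)
    fix c d assume "c \<in> C_odd (n + 1)" "d \<in> C_odd (n + 1)"
      "(inc_hd \<circ> inc_hd) c = (inc_hd \<circ> inc_hd) d"
    then show "c = d" by (cases c; cases d) (auto simp: C_odd_iff)
  qed
  have "(inc_hd \<circ> inc_hd) d \<noteq> 1 # c" for c d by (cases d) auto
  then have "(#) 1 ` C_odd (n + 2) \<inter> (inc_hd \<circ> inc_hd) ` C_odd (n + 1) = {}"
    by (auto simp del: o_apply) metis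
  then show ?thesis
    unfolding C_odd_decomp
    by (subst card_Un_disjoint)
      (simp_all only: finite_imageI finite_C_odd card_image[OF inj] card_image[OF inj_on_Cons1])
qed

text \<open>The smallest possible leading pair is 2, 1, with sum 3.\<close>

lemma D_empty: "n < 3 \<Longrightarrow> D n = {}"
  by (auto simp: D_def A_iff)

lemma card_A_1: "card (A 1) = 1" and card_A_2: "card (A 2) = 1"
proof -
  have "A 0 = {[]}"
  proof (intro set_eqI)
    fix c show "c \<in> A 0 \<longleftrightarrow> c \<in> {[]}" by (cases c) (auto simp: A_iff)
  qed
  then show 1: "card (A 1) = 1" using card_A_Suc[of 0] by (simp add: D_empty)
  then show "card (A 2) = 1" using card_A_Suc[of 1] by (simp add: D_empty numeral_2_eq_2)
qed

text \<open>Used to enumerate the small cases by first part; \<open>a \<le> n\<close> guards the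
  truncated subtraction.\<close>

lemma Cons_in_C_odd: "a # r \<in> C_odd n \<longleftrightarrow> odd a \<and> a \<le> n \<and> r \<in> C_odd (n - a)"
proof -
  have "a + sum_list r = n \<longleftrightarrow> a \<le> n \<and> sum_list r = n - a" by arith
  then show ?thesis unfolding C_odd_iff by simp blast
qed

lemma Nil_in_C_odd: "[] \<in> C_odd n \<longleftrightarrow> n = 0"
  by (auto simp: C_odd_iff)

lemma C_odd_0: "C_odd 0 = {[]}"
proof (intro set_eqI)
  fix c show "c \<in> C_odd 0 \<longleftrightarrow> c \<in> {[]}"
    by (cases c) (auto simp: Cons_in_C_odd Nil_in_C_odd)
qed

lemma C_odd_1: "C_odd 1 = {[1]}"
proof (intro set_eqI)
  fix c
  have "a # r \<in> C_odd 1 \<longleftrightarrow> a = 1 \<and> r = []" for a r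
  proof -
    have "odd a \<and> a \<le> 1 \<longleftrightarrow> a = 1" by presburger
    moreover have "r \<in> C_odd (1 - 1) \<longleftrightarrow> r = []" by (simp add: C_odd_0)
    ultimately show ?thesis unfolding Cons_in_C_odd by blast
  qed
  then show "c \<in> C_odd 1 \<longleftrightarrow> c \<in> {[1]}" by (cases c) (simp_all add: Nil_in_C_odd)
qed

lemma C_odd_2: "C_odd 2 = {[1, 1]}"
proof (intro set_eqI)
  fix c
  have "a # r \<in> C_odd 2 \<longleftrightarrow> a = 1 \<and> r = [1]" for a r
  proof -
    have "odd a \<and> a \<le> 2 \<longleftrightarrow> a = 1" by presburger
    moreover have "r \<in> C_odd (2 - 1) \<longleftrightarrow> r = [1]" using C_odd_1 by simp
    ultimately show ?thesis unfolding Cons_in_C_odd by blast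
  qed
  then show "c \<in> C_odd 2 \<longleftrightarrow> c \<in> {[1, 1]}" by (cases c) (simp_all add: Nil_in_C_odd)
qed

text \<open>The recurrence starts at 3, so 1 and 2 are both base cases. It fails at 2, as the counts
  at 0, 1 and 2 are all 1.\<close>

lemma card_A_eq_card_C_odd: "card (A (Suc n)) = card (C_odd (Suc n))"
proof (induction n rule: less_induct)
  case (less n)
  consider "n = 0" | "n = 1" | k where "n = k + 2"
    using le_Suc_ex[of 2 n] by fastforce
  then show ?case
  proof cases
    case 1
    then show ?thesis using card_A_1 C_odd_1 by simp
  next
    case 2
    then show ?thesis using card_A_2 C_odd_2 by (simp add: numeral_2_eq_2)
  next
    case 3
    then show ?thesis
      using card_A_rec[of k] card_C_odd_rec[of k] less.IH[of k] less.IH[of "k + 1"]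
      by (simp add: eval_nat_numeral)
  qed
qed

theorem theorem2p1:
  fixes n :: nat
  assumes "n \<ge> 1"
  shows "(\<exists>f. bij_betw f (A n) (C_odd n)) \<and> card (A n) = card (C_odd n)"
proof -
  obtain m where "n = Suc m" using assms by (cases n) auto
  then have "card (A n) = card (C_odd n)" by (simp add: card_A_eq_card_C_odd)
  \<comment> \<open>The bijection is not explicit; it comes from finiteness and equal
    cardinality.\<close>
  then show ?thesis using finite_same_card_bij[OF finite_A finite_C_odd] by blast
qed

end
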